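(* For every integer $n\ge 0$, $$H_n(x,(q-1)s|q)=\sum_{k=0}^{\lfloor n/2\rfloor}\binom{n}{k}s^kL_{n-2k}(x,-s)=\sum_{k=0}^{\lfloor (n+1)/2\rfloor}\left(\binom{n}{k}-\binom{n}{k-1}\right)s^kF_{n+1-2k}(x,-s).$$
   Context: $x,s,q$ are indeterminates, $[n]_q=\frac{1-q^n}{1-q}$, and $\binom{n}{-1}=0$. The new $q$-Hermite polynomials are $H_n(x,s|q):=\mathcal{F}(z^n)$, where $\mathcal{F}$ is the linear functional on polynomials in $z$ determined by $\mathcal{F}(P_n(z))=\delta_{n,0}$ for all $n\ge0$, with $P_{-1}=0$, $P_0=1$, $P_{n+1}(z)=(z-xq^n)P_n(z)+s[n]_qP_{n-1}(z)$. The $q$-derivative is $(\mathcal{D}_qf)(x)=\frac{f(x)-f(qx)}{(1-q)x}$. The Lucas polynomials are $l_0(x,s)=1$ (not the usual value $2$), $l_1(x,s)=x$, $l_2(x,s)=x^2+2s$, $l_n(x,s)=xl_{n-1}(x,s)+sl_{n-2}(x,s)$ for $n>2$. The Fibonacci polynomials are $f_0(x,s)=0$, $f_1(x,s)=1$, $f_n(x,s)=xf_{n-1}(x,s)+sf_{n-2}(x,s)$ for $n\ge 2$. The $q$-Lucas and $q$-Fibonacci polynomials are $L_n(x,s)=l_n(x+(q-1)s\mathcal{D}_q,s)\cdot 1$ and $F_n(x,s)=f_n(x+(q-1)s\mathcal{D}_q,s)\cdot 1$. That is, the operator $f\mapsto xf+(q-1)s\mathcal{D}_qf$ is substituted for the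 first variable, and the resulting operator is applied to the constant $1$. In particular $L_0=1$ and $F_0=0$. *)

theory Defs
  imports "HOL-Computational_Algebra.Polynomial"
begin

(* Polynomials in x are elements of 'a poly, where the coefficient ring 'a contains s and q;
   polynomials in z over them are elements of 'a poly poly.  All divisions below are the
   exact divisions of idom_divide (see the lemmas q_int_exact and q_deriv_exact). *)

definition q_int :: "'a::idom_divide \<Rightarrow> nat \<Rightarrow> 'a" where
  "q_int q n = (1 - q ^ n) div (1 - q)"

definition q_deriv :: "'a::idom_divide \<Rightarrow> 'a poly \<Rightarrow> 'a poly" where
  "q_deriv q f = (f - pcompose f [:0, q:]) div [:0, 1 - q:]"

(* The first two equations incorporate P_{-1} = 0. *)
fun P_poly :: "nat \<Rightarrow> 'a::idom_divide \<Rightarrow> 'a \<Rightarrow> 'a poly poly" where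
  "P_poly 0 s q = 1"
| "P_poly (Suc 0) s q = [:- [:0, 1:], 1:]"
| "P_poly (Suc (Suc n)) s q =
     [:- [:0, q ^ Suc n:], 1:] * P_poly (Suc n) s q
     + smult [:s * q_int q (Suc n):] (P_poly n s q)"

definition is_q_Hermite_functional ::
    "'a::idom_divide \<Rightarrow> 'a \<Rightarrow> ('a poly poly \<Rightarrow> 'a poly) \<Rightarrow> bool" where
  "is_q_Hermite_functional s q F \<longleftrightarrow>
     module_hom smult (*) F \<and> (\<forall>n. F (P_poly n s q) = (if n = 0 then 1 else 0))"

definition q_Hermite_functional :: "'a::idom_divide \<Rightarrow> 'a \<Rightarrow> 'a poly poly \<Rightarrow> 'a poly" where
  "q_Hermite_functional s q = (THE F. is_q_Hermite_functional s q F)"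

definition q_Hermite :: "nat \<Rightarrow> 'a::idom_divide \<Rightarrow> 'a \<Rightarrow> 'a poly" where
  "q_Hermite n s q = q_Hermite_functional s q (monom 1 n)"

fun lucas_poly :: "nat \<Rightarrow> 'a::idom_divide \<Rightarrow> 'a poly" where
  "lucas_poly 0 s = 1"
| "lucas_poly (Suc 0) s = [:0, 1:]"
| "lucas_poly (Suc (Suc 0)) s = [:0, 1:] ^ 2 + [:2 * s:]"
| "lucas_poly (Suc (Suc (Suc n))) s =
     [:0, 1:] * lucas_poly (Suc (Suc n)) s + smult s (lucas_poly (Suc n) s)"

fun fibonacci_poly :: "nat \<Rightarrow> 'a::idom_divide \<Rightarrow> 'a poly" where
  "fibonacci_poly 0 s = 0"
| "fibonacci_poly (Suc 0) s = 1"
| "fibonacci_poly (Suc (Suc n)) s =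
     [:0, 1:] * fibonacci_poly (Suc n) s + smult s (fibonacci_poly n s)"

(* The operator p(T), where the variable of p is replaced by the operator T. *)
definition subst_operator ::
    "'a::idom_divide poly \<Rightarrow> ('a poly \<Rightarrow> 'a poly) \<Rightarrow> 'a poly \<Rightarrow> 'a poly" where
  "subst_operator p T f = (\<Sum>i\<le>degree p. smult (coeff p i) ((T ^^ i) f))"

definition x_operator :: "'a::idom_divide \<Rightarrow> 'a \<Rightarrow> 'a poly \<Rightarrow> 'a poly" where
  "x_operator s q f = [:0, 1:] * f + smult ((q - 1) * s) (q_deriv q f)"

definition q_Lucas :: "nat \<Rightarrow> 'a::idom_divide \<Rightarrow> 'a \<Rightarrow> 'a poly" where
  "q_Lucas n s q = subst_operator (lucas_poly n s) (x_operator s q) 1"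

definition q_Fibonacci :: "nat \<Rightarrow> 'a::idom_divide \<Rightarrow> 'a \<Rightarrow> 'a poly" where
  "q_Fibonacci n s q = subst_operator (fibonacci_poly n s) (x_operator s q) 1"

(* The indeterminates s and q as elements of k[q][s]. *)
definition s_var :: "'k::idom_divide poly poly" where
  "s_var = [:0, 1:]"

definition q_var :: "'k::idom_divide poly poly" where
  "q_var = [:[:0, 1:]:]"

lemma q_int_exact:
  assumes "q \<noteq> 1"
  shows "(1 - q) * q_int q n = 1 - q ^ n"
proof -
  have "1 - q ^ n = (1 - q) * (\<Sum>i<n. q ^ i)"
    by (rule one_diff_power_eq)
  then show ?thesis
    using assms nonzero_mult_div_cancel_left[of "1 - q" "\<Sum>i<n. q ^ i"]
    by (simp add: q_int_def)
qed

lemma q_deriv_exact: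
  assumes "q \<noteq> 1"
  shows "[:0, 1 - q:] * q_deriv q f = f - pcompose f [:0, q:]"
proof -
  have "[:0, 1 - q:] dvd f - pcompose f [:0, q:]"
  proof (induction f)
    case 0
    then show ?case by simp
  next
    case (pCons a p)
    have "pCons a p - pcompose (pCons a p) [:0, q:]
        = [:0, q:] * (p - pcompose p [:0, q:]) + [:0, 1 - q:] * p"
      by (simp add: pcompose_pCons smult_diff_right smult_diff_left)
    moreover have "[:0, 1 - q:] dvd [:0, q:] * (p - pcompose p [:0, q:])"
      using pCons.IH by (rule dvd_mult)
    ultimately show ?case by (simp only: dvd_add dvd_triv_left)
  qed
  then show ?thesis by (simp only: q_deriv_def dvd_mult_div_cancel)
qed

lemma P_poly_degree_monic:
  "degree (P_poly n s q) = n \<and> lead_coeff (P_poly n s q) = 1"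
proof (induction n s q rule: P_poly.induct)
  case (3 n s q)
  let ?A = "[:- [:0, q ^ Suc n:], 1:] * P_poly (Suc n) s q"
  let ?B = "smult [:s * q_int q (Suc n):] (P_poly n s q)"
  have ne: "P_poly (Suc n) s q \<noteq> 0" using 3 by auto
  have dA: "degree ?A = Suc (Suc n)"
    using 3 ne by (subst degree_mult_eq) auto
  have lA: "lead_coeff ?A = 1"
    using 3 by (subst lead_coeff_mult) auto
  have dB: "degree ?B < degree ?A"
    using 3 dA degree_smult_le[of "[:s * q_int q (Suc n):]" "P_poly n s q"] by linarith
  have "degree (?A + ?B) = Suc (Suc n)" using degree_add_eq_left[OF dB] dA by simp
  moreover have "lead_coeff (?A + ?B) = 1"
    using lead_coeff_add_le[of ?B ?A] dB lA by (simp add: add.commute)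
  ultimately show ?case by simp
qed simp_all

fun q_Hermite_moment :: "'a::idom_divide \<Rightarrow> 'a \<Rightarrow> nat \<Rightarrow> 'a poly" where
  "q_Hermite_moment s q n =
     (if n = 0 then 1 else 0) - (\<Sum>i<n. coeff (P_poly n s q) i * q_Hermite_moment s q i)"

declare q_Hermite_moment.simps [simp del]

lemma is_q_Hermite_functional_ex1: "\<exists>!F. is_q_Hermite_functional s q F"
proof -
  have monom_expand: "F p = (\<Sum>i\<le>degree p. coeff p i * F (monom 1 i))"
    if "module_hom smult (*) F" for F :: "'a poly poly \<Rightarrow> 'a poly" and p
  proof -
    interpret module_hom smult "(*)" F by fact
    have "F p = F (\<Sum>i\<le>degree p. smult (coeff p i) (monom 1 i))"
      by (simp add: smult_monom poly_as_sum_of_monoms)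
    also have "\<dots> = (\<Sum>i\<le>degree p. coeff p i * F (monom 1 i))"
      by (simp add: sum scale)
    finally show ?thesis .
  qed
  define G where "G p = (\<Sum>i\<le>degree p. coeff p i * q_Hermite_moment s q i)" for p
  have G_bound: "G p = (\<Sum>i\<le>m. coeff p i * q_Hermite_moment s q i)" if "degree p \<le> m" for p m
    unfolding G_def using that
    by (intro sum.mono_neutral_left) (auto simp: coeff_eq_0)
  have G_hom: "module_hom smult (*) G"
  proof
    fix p r :: "'a poly poly"
    let ?m = "max (degree p) (degree r)"
    have "degree (p + r) \<le> ?m" by (rule degree_add_le_max)
    then show "G (p + r) = G p + G r"
      using G_bound[of p ?m] G_bound[of r ?m] G_bound[of "p + r" ?m]
      by (simp add: algebra_simps sum.distrib)
  next
    fix c :: "'a poly" and p :: "'a poly poly"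
    show "G (smult c p) = c * G p"
      using G_bound[OF degree_smult_le[of c p]] G_def[of p]
      by (simp add: algebra_simps sum_distrib_left)
  qed (simp_all add: algebra_simps smult_add_right smult_add_left)
  have G_P: "G (P_poly n s q) = (if n = 0 then 1 else 0)" for n
  proof -
    have d: "degree (P_poly n s q) = n" "coeff (P_poly n s q) n = 1"
      using P_poly_degree_monic[of n s q] by auto
    have "G (P_poly n s q)
        = (\<Sum>i<n. coeff (P_poly n s q) i * q_Hermite_moment s q i) + q_Hermite_moment s q n"
      unfolding G_def d(1) by (simp add: lessThan_Suc_atMost[symmetric] d(2))
    then show ?thesis by (simp add: q_Hermite_moment.simps[of s q n])
  qed
  show ?thesis
  proof (rule ex1I[of _ G])
    show "is_q_Hermite_functional s q G"
      using G_hom G_P by (simp add: is_q_Hermite_functional_def)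
  next
    fix F assume "is_q_Hermite_functional s q F"
    then have F: "module_hom smult (*) F"
      and FP: "\<And>n. F (P_poly n s q) = (if n = 0 then 1 else 0)"
      by (auto simp: is_q_Hermite_functional_def)
    have moment: "F (monom 1 n) = q_Hermite_moment s q n" for n
    proof (induction n rule: less_induct)
      case (less n)
      have d: "degree (P_poly n s q) = n" "coeff (P_poly n s q) n = 1"
        using P_poly_degree_monic[of n s q] by auto
      have "(if n = 0 then 1 else 0)
          = (\<Sum>i<n. coeff (P_poly n s q) i * F (monom 1 i)) + F (monom 1 n)"
        using monom_expand[OF F, of "P_poly n s q"]
        unfolding FP d(1) by (simp add: lessThan_Suc_atMost[symmetric] d(2))
      also have "(\<Sum>i<n. coeff (P_poly n s q) i * F (monom 1 i))
          = (\<Sum>i<n. coeff (P_poly n s q) i * q_Hermite_moment s q i)"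
        using less by (intro sum.cong) auto
      finally show ?case
        by (simp add: q_Hermite_moment.simps[of s q n] eq_diff_eq add.commute)
    qed
    show "F = G"
    proof
      fix p
      show "F p = G p"
        unfolding G_def moment[symmetric] by (rule monom_expand[OF F])
    qed
  qed
qed

end

theory Submission
  imports Defs
begin

text \<open>
  Both sums are expansions of one and the same object, \<open>A\<^sup>n \<cdot> 1\<close> with
  \<open>A = x + (1 - q) s D\<close>, where \<open>D\<close> is the \<open>q\<close>-derivative.

  For the sums this has nothing to do with \<open>q\<close>: if \<open>\<alpha> + \<beta> = x\<close> and \<open>\<alpha> \<beta> = s\<close>, then
  \<open>l\<^sub>m(x, -s) = \<alpha>\<^sup>m + \<beta>\<^sup>m\<close> for positive \<open>m\<close>, and pairing the terms \<open>k\<close> and \<open>n - k\<close> of the binomial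
  expansion of \<open>(\<alpha> + \<beta>)\<^sup>n\<close> writes \<open>x\<^sup>n\<close> in terms of Lucas polynomials; the unpaired middle term is
  the reason for the convention \<open>l\<^sub>0 = 1\<close>. By \<open>l\<^sub>m(x, -s) = f\<^sub>m\<^sub>+\<^sub>1(x, -s) - s f\<^sub>m\<^sub>-\<^sub>1(x, -s)\<close> this is
  equivalent to the Fibonacci expansion (\<open>lucas_sum_eq_fibonacci_sum\<close>). The latter is the one to prove
  by induction (\<open>monom_eq_fibonacci_sum\<close>), because the Fibonacci recurrence, unlike the Lucas one,
  has no exception at small indices. Substituting the operator \<open>A\<close> for \<open>x\<close> is linear, so these
  ordinary polynomial identities carry over.

  For the \<open>q\<close>-Hermite polynomials, put \<open>t = (q - 1) s\<close> and \<open>E = -t D\<close>, so that \<open>A = x + E\<close>.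
  Send a polynomial in \<open>z\<close> to an operator by replacing \<open>z\<^sup>i\<close> with \<open>A\<^sup>i\<close>, all coefficients in \<open>x\<close> being
  kept on the left. Multiplication by \<open>z\<close> becomes composition with \<open>A\<close> on the right. The commutation
  rule \<open>E\<^sup>n x = q\<^sup>n x E\<^sup>n - t [n] E\<^sup>n\<^sup>-\<^sup>1\<close> then says exactly that the operators \<open>E\<^sup>n\<close> satisfy the recurrence
  of the \<open>P\<^sub>n\<close>, so \<open>P\<^sub>n\<close> is sent to \<open>E\<^sup>n\<close> (\<open>left_ordered_P_poly\<close>). Since \<open>E\<close> annihilates constants,
  applying these operators to \<open>1\<close> is the functional that defines the \<open>q\<close>-Hermite polynomials, and
  \<open>H\<^sub>n(x, t | q) = A\<^sup>n \<cdot> 1\<close> (\<open>q_Hermite_eq_operator_power\<close>).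
\<close>

section \<open>Linear extension from powers\<close>

text \<open>Serves both for scalar coefficients acting on polynomials in \<open>x\<close>, as in the substitution of an
  operator, and for coefficients that are themselves polynomials in \<open>x\<close>.\<close>

lemma module_hom_linear_extension:
  fixes scale :: "'a::idom_divide \<Rightarrow> 'b::ab_group_add \<Rightarrow> 'b"
  assumes "module scale"
  shows "module_hom smult scale (\<lambda>p. \<Sum>i\<le>degree p. scale (coeff p i) (g i))"
proof -
  interpret module scale by fact
  define G where "G p = (\<Sum>i\<le>degree p. scale (coeff p i) (g i))" for p
  have G_bound: "G p = (\<Sum>i\<le>m. scale (coeff p i) (g i))" if "degree p \<le> m" for p m
    unfolding G_def using that by (intro sum.mono_neutral_left) (auto simp: coeff_eq_0)
  have "module_hom smult scale G"
  proof
    fix p r :: "'a poly"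
    let ?m = "max (degree p) (degree r)"
    have "degree (p + r) \<le> ?m" by (rule degree_add_le_max)
    then show "G (p + r) = G p + G r"
      using G_bound[of p ?m] G_bound[of r ?m] G_bound[of "p + r" ?m]
      by (simp add: scale_left_distrib sum.distrib)
  next
    fix c :: 'a and p :: "'a poly"
    show "G (smult c p) = scale c (G p)"
      using G_bound[OF degree_smult_le[of c p]] G_def[of p]
      by (simp add: scale_sum_right)
  qed (simp_all add: smult_add_right smult_add_left)
  then show ?thesis by (simp add: G_def[abs_def])
qed

lemma module_smult: "module (smult :: 'a::idom_divide \<Rightarrow> 'a poly \<Rightarrow> 'a poly)"
  by standard (simp_all add: smult_add_right smult_add_left)

lemma module_times: "module ((*) :: 'a::idom_divide \<Rightarrow> 'a \<Rightarrow> 'a)"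
  by standard (simp_all add: algebra_simps)

lemma module_hom_subst_operator: "module_hom smult smult (\<lambda>p. subst_operator p T f)"
  unfolding subst_operator_def by (rule module_hom_linear_extension[OF module_smult])

lemma subst_operator_monom: "subst_operator (monom 1 n) T f = (T ^^ n) f"
proof -
  have "subst_operator (monom 1 n) T f = (\<Sum>i\<le>n. if i = n then (T ^^ i) f else 0)"
    unfolding subst_operator_def by (rule sum.cong) (auto simp: degree_monom_eq)
  then show ?thesis by simp
qed

text \<open>A polynomial in \<open>z\<close> with coefficients in \<open>x\<close>, applied to \<open>f\<close> with \<open>T\<close> in place of \<open>z\<close>. The
  multiplication by the coefficients does not commute with \<open>T\<close> and is performed last.\<close>

definition left_ordered ::
    "('a::idom_divide poly \<Rightarrow> 'a poly) \<Rightarrow> 'a poly poly \<Rightarrow> 'a poly \<Rightarrow> 'a poly" where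
  "left_ordered T p f = (\<Sum>i\<le>degree p. coeff p i * (T ^^ i) f)"

lemma module_hom_left_ordered: "module_hom smult (*) (\<lambda>p. left_ordered T p f)"
  unfolding left_ordered_def by (rule module_hom_linear_extension[OF module_times])

lemma left_ordered_add: "left_ordered T (p + r) f = left_ordered T p f + left_ordered T r f"
  by (rule module_hom.add[OF module_hom_left_ordered])

lemma left_ordered_smult: "left_ordered T (smult c p) f = c * left_ordered T p f"
  by (rule module_hom.scale[OF module_hom_left_ordered])

lemma left_ordered_1: "left_ordered T 1 f = f"
  by (simp add: left_ordered_def)

lemma left_ordered_monom: "left_ordered T (monom 1 n) f = (T ^^ n) f"
proof -
  have "left_ordered T (monom 1 n) f = (\<Sum>i\<le>n. if i = n then (T ^^ i) f else 0)"
    unfolding left_ordered_def by (rule sum.cong) (auto simp: degree_monom_eq)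
  then show ?thesis by simp
qed

text \<open>As the coefficients stay on the left, an additional factor \<open>z\<close> acts first.\<close>

lemma left_ordered_pCons:
  "left_ordered T (pCons c p) f = c * f + left_ordered T p (T f)"
proof (cases "p = 0")
  case True
  then show ?thesis by (cases "c = 0") (simp_all add: left_ordered_def)
next
  case False
  then show ?thesis
    unfolding left_ordered_def
    by (simp add: sum.atMost_Suc_shift funpow_Suc_right del: funpow.simps sum.atMost_Suc)
qed

lemma left_ordered_linear_factor:
  "left_ordered T ([:c, 1:] * p) f = c * left_ordered T p f + left_ordered T p (T f)"
  by (simp add: left_ordered_add left_ordered_smult left_ordered_pCons)

section \<open>The commutation rule of the q-derivative\<close>

lemma q_deriv_eqI:
  assumes "q \<noteq> 1" "[:0, 1 - q:] * g = f - pcompose f [:0, q:]"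
  shows "q_deriv q f = g"
proof -
  have "[:0, 1 - q:] * q_deriv q f = [:0, 1 - q:] * g"
    using q_deriv_exact[OF assms(1), of f] assms(2) by simp
  moreover have "[:0, 1 - q:] \<noteq> 0" using assms(1) by simp
  ultimately show ?thesis by (simp only: mult_cancel_left) blast
qed

lemma q_deriv_1: "q \<noteq> 1 \<Longrightarrow> q_deriv q 1 = 0"
  by (rule q_deriv_eqI) (simp_all add: pcompose_1)

lemma q_deriv_add:
  assumes "q \<noteq> 1"
  shows "q_deriv q (f + g) = q_deriv q f + q_deriv q g"
  by (rule q_deriv_eqI[OF assms])
    (simp only: distrib_left q_deriv_exact[OF assms] pcompose_add add_diff_add)

lemma q_deriv_smult:
  assumes "q \<noteq> 1"
  shows "q_deriv q (smult c f) = smult c (q_deriv q f)"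
  by (rule q_deriv_eqI[OF assms])
    (simp only: mult_smult_right q_deriv_exact[OF assms] pcompose_smult smult_diff_right)

lemma q_deriv_times_x:
  assumes "q \<noteq> 1"
  shows "q_deriv q ([:0, 1:] * f) = f + smult q ([:0, 1:] * q_deriv q f)"
proof (rule q_deriv_eqI[OF assms])
  have "[:0, 1 - q:] * (f + smult q ([:0, 1:] * q_deriv q f))
      = [:0, 1 - q:] * f + [:0, q:] * ([:0, 1 - q:] * q_deriv q f)"
    by (simp add: algebra_simps smult_add_right)
  also have "\<dots> = [:0, 1 - q:] * f + [:0, q:] * (f - pcompose f [:0, q:])"
    by (simp only: q_deriv_exact[OF assms])
  also have "\<dots> = ([:0, 1 - q:] + [:0, q:]) * f - [:0, q:] * pcompose f [:0, q:]"
    by (simp only: algebra_simps)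
  also have "\<dots> = [:0, 1:] * f - pcompose ([:0, 1:] * f) [:0, q:]"
    by (simp add: pcompose_mult pcompose_pCons)
  finally show "[:0, 1 - q:] * (f + smult q ([:0, 1:] * q_deriv q f))
      = [:0, 1:] * f - pcompose ([:0, 1:] * f) [:0, q:]" .
qed

lemma q_int_Suc:
  assumes "q \<noteq> 1"
  shows "q_int q (Suc n) = 1 + q * q_int q n"
proof -
  have "(1 - q) * q_int q (Suc n) = (1 - q) * 1 + q * ((1 - q) * q_int q n)"
    by (simp only: q_int_exact[OF assms]) (simp add: algebra_simps)
  also have "\<dots> = (1 - q) * (1 + q * q_int q n)"
    by (simp add: algebra_simps)
  finally show ?thesis using assms by (simp only: mult_cancel_left) simp
qed

definition lowering :: "'a::idom_divide \<Rightarrow> 'a \<Rightarrow> 'a poly \<Rightarrow> 'a poly" where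
  "lowering t q f = smult (- t) (q_deriv q f)"

lemma lowering_add: "q \<noteq> 1 \<Longrightarrow> lowering t q (f + g) = lowering t q f + lowering t q g"
  by (simp add: lowering_def q_deriv_add smult_add_right)

lemma lowering_smult: "q \<noteq> 1 \<Longrightarrow> lowering t q (smult c f) = smult c (lowering t q f)"
  by (simp add: lowering_def q_deriv_smult mult.commute)

lemma lowering_power_add:
  "q \<noteq> 1 \<Longrightarrow> (lowering t q ^^ n) (f + g) = (lowering t q ^^ n) f + (lowering t q ^^ n) g"
  by (induction n) (simp_all add: lowering_add)

lemma lowering_power_1: "q \<noteq> 1 \<Longrightarrow> (lowering t q ^^ n) 1 = (if n = 0 then 1 else 0)"
proof (induction n)
  case (Suc n)
  have "lowering t q 0 = 0" "lowering t q 1 = 0"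
    using Suc.prems lowering_smult[of q t 0 0] by (simp_all add: lowering_def q_deriv_1)
  then show ?case using Suc by simp
qed simp

lemma lowering_times_x:
  "q \<noteq> 1 \<Longrightarrow> lowering t q ([:0, 1:] * f)
     = smult q ([:0, 1:] * lowering t q f) + smult (- t) f"
  unfolding lowering_def q_deriv_times_x
  by (simp add: smult_add_right mult.commute)

lemma lowering_power_times_x:
  assumes "q \<noteq> 1"
  shows "(lowering t q ^^ Suc n) ([:0, 1:] * f)
    = smult (q ^ Suc n) ([:0, 1:] * (lowering t q ^^ Suc n) f)
      + smult (- (t * q_int q (Suc n))) ((lowering t q ^^ n) f)"
proof (induction n)
  case 0
  have "q_int q 0 = 0" by (simp add: q_int_def)
  then show ?case
    using lowering_times_x[OF assms] by (simp add: q_int_Suc[OF assms])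
next
  case (Suc n)
  let ?E = "lowering t q"
  let ?g = "(?E ^^ Suc n) f"
  have "(?E ^^ Suc (Suc n)) ([:0, 1:] * f)
      = ?E (smult (q ^ Suc n) ([:0, 1:] * ?g)
          + smult (- (t * q_int q (Suc n))) ((?E ^^ n) f))"
    using Suc.IH by simp
  also have "\<dots> = smult (q ^ Suc n) (smult q ([:0, 1:] * ?E ?g) + smult (- t) ?g)
      + smult (- (t * q_int q (Suc n))) ?g"
    by (simp only: lowering_add[OF assms] lowering_smult[OF assms] lowering_times_x[OF assms]
        funpow.simps comp_apply)
  also have "\<dots> = smult (q ^ Suc (Suc n)) ([:0, 1:] * ?E ?g)
      + smult (- (t * (q ^ Suc n + q_int q (Suc n)))) ?g"
    by (simp add: smult_add_right smult_diff_right smult_add_left smult_diff_left distrib_left ac_simps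
        del: funpow.simps mult_pCons_left)
  also have "q ^ Suc n + q_int q (Suc n) = q_int q (Suc (Suc n))"
  proof -
    have "(1 - q) * (q ^ Suc n + q_int q (Suc n)) = (1 - q) * q_int q (Suc (Suc n))"
      by (simp only: distrib_left q_int_exact[OF assms]) (simp add: algebra_simps)
    then show ?thesis using assms by (simp only: mult_cancel_left) simp
  qed
  finally show ?case by simp
qed

section \<open>The q-Hermite polynomials as operator powers\<close>

lemma x_operator_eq: "x_operator (- s) q f = [:0, 1:] * f + lowering ((q - 1) * s) q f"
  by (simp add: x_operator_def lowering_def)

text \<open>The recurrence of the \<open>P\<^sub>n\<close> is the commutation rule for powers of the lowering operator, solved
  for the next power.\<close>

lemma left_ordered_P_poly:
  fixes q t :: "'a::idom_divide"
  assumes "q \<noteq> 1"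
  defines "A \<equiv> \<lambda>f. [:0, 1:] * f + lowering t q f"
  shows "left_ordered A (P_poly n t q) f = (lowering t q ^^ n) f"
proof (induction n arbitrary: f rule: less_induct)
  case (less n)
  consider "n = 0" | "n = 1" | m where "n = Suc (Suc m)"
    by (metis One_nat_def not0_implies_Suc)
  then show ?case
  proof cases
    case 1
    then show ?thesis by (simp add: left_ordered_1)
  next
    case 2
    then show ?thesis
      using left_ordered_linear_factor[of A "- [:0, 1:]" 1 f]
      by (simp add: left_ordered_1 A_def)
  next
    case 3
    let ?E = "lowering t q"
    have IH: "left_ordered A (P_poly (Suc m) t q) g = (?E ^^ Suc m) g"
      "left_ordered A (P_poly m t q) g = (?E ^^ m) g" for g
      using less.IH 3 by simp_all
    have "left_ordered A (P_poly n t q) f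
        = - [:0, q ^ Suc m:] * (?E ^^ Suc m) f + (?E ^^ Suc m) (A f)
          + [:t * q_int q (Suc m):] * (?E ^^ m) f"
      unfolding 3 P_poly.simps left_ordered_add left_ordered_smult left_ordered_linear_factor IH ..
    also have "(?E ^^ Suc m) (A f)
        = smult (q ^ Suc m) ([:0, 1:] * (?E ^^ Suc m) f)
          + smult (- (t * q_int q (Suc m))) ((?E ^^ m) f) + (?E ^^ Suc m) (?E f)"
      unfolding A_def lowering_power_add[OF assms(1)] lowering_power_times_x[OF assms(1)] ..
    also have "(?E ^^ Suc m) (?E f) = (?E ^^ n) f"
      unfolding 3 by (simp only: funpow_Suc_right[of "Suc m"] comp_apply)
    finally show ?thesis by (simp del: funpow.simps)
  qed
qed

theorem q_Hermite_eq_operator_power: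
  fixes q :: "'a::idom_divide"
  assumes "q \<noteq> 1"
  shows "q_Hermite n ((q - 1) * s) q = (x_operator (- s) q ^^ n) 1"
proof -
  let ?t = "(q - 1) * s"
  let ?F = "\<lambda>p. left_ordered (x_operator (- s) q) p 1"
  have "x_operator (- s) q = (\<lambda>f. [:0, 1:] * f + lowering ?t q f)"
    by (rule ext) (rule x_operator_eq)
  then have "?F (P_poly n ?t q) = (if n = 0 then 1 else 0)" for n
    using left_ordered_P_poly[OF assms, of ?t n 1] by (simp add: lowering_power_1[OF assms])
  then have "is_q_Hermite_functional ?t q ?F"
    unfolding is_q_Hermite_functional_def using module_hom_left_ordered by blast
  then have "q_Hermite_functional ?t q = ?F"
    unfolding q_Hermite_functional_def
    by (rule the1_equality[OF is_q_Hermite_functional_ex1])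
  then show ?thesis by (simp add: q_Hermite_def left_ordered_monom)
qed

section \<open>Powers in terms of Lucas and Fibonacci polynomials\<close>

text \<open>The ballot numbers, in the ring of coefficients so that they may be negative.\<close>

definition ballot :: "nat \<Rightarrow> nat \<Rightarrow> 'a::comm_ring_1" where
  "ballot n k = of_nat (n choose k) - (if k = 0 then 0 else of_nat (n choose (k - 1)))"

lemma ballot_Suc_Suc: "ballot (Suc n) (Suc k) = ballot n (Suc k) + ballot n k"
  by (cases k) (simp_all add: ballot_def)

lemma ballot_middle: "n + 1 = 2 * k \<Longrightarrow> ballot n k = 0"
  using binomial_symmetric[of k n] by (cases k) (simp_all add: ballot_def)

text \<open>Truncated subtraction is harmless in the following indices: it can only produce \<open>f\<^sub>0 = 0\<close>, so
  the sums may be extended to any convenient range.\<close>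

lemma fibonacci_sum_extend:
  assumes "(n + 1) div 2 \<le> m"
  shows "(\<Sum>k=0..(n + 1) div 2. smult (c k) (fibonacci_poly (n + 1 - 2 * k) s))
    = (\<Sum>k\<le>m. smult (c k) (fibonacci_poly (n + 1 - 2 * k) s))"
  using assms by (intro sum.mono_neutral_left) auto

lemma x_times_fibonacci_poly:
  "[:0, 1:] * fibonacci_poly (Suc m) (- s)
     = fibonacci_poly (Suc (Suc m)) (- s) + smult s (fibonacci_poly m (- s))"
  by simp

lemma monom_eq_fibonacci_sum_extended:
  "monom 1 n
     = (\<Sum>k\<le>n + 1. smult (ballot n k * s ^ k) (fibonacci_poly (n + 1 - 2 * k) (- s)))"
proof (induction n)
  case 0
  show ?case by (simp add: ballot_def)
next
  case (Suc n)
  let ?f = "\<lambda>m. fibonacci_poly m (- s)"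
  \<comment> \<open>The three-term recurrence with truncated indices fails only at \<open>n + 1 = 2 k\<close>, where
    \<open>x f\<^sub>0 = 0\<close> but \<open>f\<^sub>1 = 1\<close>; there the ballot number vanishes.\<close>
  have step: "[:0, 1:] * smult (ballot n k * s ^ k) (?f (n + 1 - 2 * k))
      = smult (ballot n k * s ^ k) (?f (n + 2 - 2 * k))
        + smult (ballot n k * s ^ Suc k) (?f (n + 2 - 2 * Suc k))" for k
  proof -
    consider "2 * k \<le> n" | "n + 1 = 2 * k" | "n + 1 < 2 * k" by linarith
    then show ?thesis
    proof cases
      case 1
      then obtain m where m: "n = m + 2 * k" using le_Suc_ex add.commute by metis
      show ?thesis
        unfolding m mult_smult_right
        using x_times_fibonacci_poly[of m s] by (simp add: smult_add_right smult_diff_right ac_simps)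
    qed (simp_all add: ballot_middle)
  qed
  have "monom 1 (Suc n) = [:0, 1:] * monom (1 :: 'a) n"
    by (simp add: monom_Suc)
  also have "\<dots> = (\<Sum>k\<le>n + 1. smult (ballot n k * s ^ k) (?f (n + 2 - 2 * k)))
      + (\<Sum>k\<le>n + 1. smult (ballot n k * s ^ Suc k) (?f (n + 2 - 2 * Suc k)))"
    unfolding Suc.IH sum_distrib_left step sum.distrib ..
  also have "(\<Sum>k\<le>n + 1. smult (ballot n k * s ^ k) (?f (n + 2 - 2 * k)))
      = (\<Sum>k\<le>Suc (n + 1). smult (ballot n k * s ^ k) (?f (n + 2 - 2 * k)))"
    by simp
  also have "\<dots> = smult (ballot n 0) (?f (n + 2))
      + (\<Sum>k\<le>n + 1. smult (ballot n (Suc k) * s ^ Suc k) (?f (n + 2 - 2 * Suc k)))"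
    by (subst sum.atMost_Suc_shift) simp
  also have "\<dots> + (\<Sum>k\<le>n + 1. smult (ballot n k * s ^ Suc k) (?f (n + 2 - 2 * Suc k)))
      = smult (ballot (Suc n) 0) (?f (n + 2))
      + (\<Sum>k\<le>n + 1. smult (ballot (Suc n) (Suc k) * s ^ Suc k) (?f (n + 2 - 2 * Suc k)))"
    unfolding add.assoc sum.distrib[symmetric] smult_add_left[symmetric]
      distrib_right[symmetric] ballot_Suc_Suc[symmetric] by (simp add: ballot_def)
  also have "\<dots> = (\<Sum>k\<le>Suc (n + 1). smult (ballot (Suc n) k * s ^ k) (?f (n + 2 - 2 * k)))"
    by (subst sum.atMost_Suc_shift) simp
  finally show ?case by simp
qed

lemma monom_eq_fibonacci_sum:
  "monom 1 n
     = (\<Sum>k=0..(n + 1) div 2.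
          smult (ballot n k * s ^ k) (fibonacci_poly (n + 1 - 2 * k) (- s)))"
  unfolding monom_eq_fibonacci_sum_extended[of n s]
  by (rule fibonacci_sum_extend[symmetric]) simp

lemma lucas_poly_eq_fibonacci_poly:
  "lucas_poly (Suc m) s = fibonacci_poly (Suc (Suc m)) s + smult s (fibonacci_poly m s)"
proof (induction m rule: less_induct)
  case (less m)
  consider "m = 0" | "m = 1" | j where "m = Suc (Suc j)"
    by (metis One_nat_def not0_implies_Suc)
  then show ?case
  proof cases
    case 3
    then show ?thesis
      using less.IH[of j] less.IH[of "Suc j"] by (simp add: smult_add_right algebra_simps)
  qed (simp_all add: power2_eq_square)
qed

text \<open>Each Lucas polynomial splits into two Fibonacci polynomials with indices two apart, and the
  binomial coefficients at \<open>k\<close> and \<open>k - 1\<close> that meet at one index combine to a ballot number.\<close>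

lemma lucas_sum_eq_fibonacci_sum:
  "(\<Sum>k=0..n div 2. smult (of_nat (n choose k) * s ^ k) (lucas_poly (n - 2 * k) (- s)))
     = (\<Sum>k=0..(n + 1) div 2.
          smult (ballot n k * s ^ k) (fibonacci_poly (n + 1 - 2 * k) (- s)))"
proof -
  let ?f = "\<lambda>m. fibonacci_poly m (- s)"
  let ?b = "\<lambda>k. of_nat (n choose k) :: 'a"
  \<comment> \<open>For \<open>n = 2 k\<close> the correction term is a truncated \<open>f\<^sub>0\<close>, matching the convention \<open>l\<^sub>0 = 1\<close>.\<close>
  have split: "smult (?b k * s ^ k) (lucas_poly (n - 2 * k) (- s))
      = smult (?b k * s ^ k) (?f (n + 1 - 2 * k))
        - smult (?b k * s ^ Suc k) (?f (n + 1 - 2 * Suc k))" if "k \<in> {0..n div 2}" for k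
  proof -
    have "2 * k \<le> n" using that by auto
    then obtain m where m: "n = m + 2 * k" using le_Suc_ex add.commute by metis
    show ?thesis
    proof (cases m)
      case 0
      then show ?thesis using m by simp
    next
      case (Suc j)
      then show ?thesis
        using lucas_poly_eq_fibonacci_poly[of j "- s"] m
        by (simp add: smult_diff_right ac_simps
            del: fibonacci_poly.simps lucas_poly.simps)
    qed
  qed
  have "(\<Sum>k=0..n div 2. smult (?b k * s ^ k) (lucas_poly (n - 2 * k) (- s)))
      = (\<Sum>k=0..n div 2. smult (?b k * s ^ k) (?f (n + 1 - 2 * k))
          - smult (?b k * s ^ Suc k) (?f (n + 1 - 2 * Suc k)))"
    by (rule sum.cong[OF refl split])
  also have "\<dots> = (\<Sum>k\<le>n. smult (?b k * s ^ k) (?f (n + 1 - 2 * k))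
          - smult (?b k * s ^ Suc k) (?f (n + 1 - 2 * Suc k)))"
    by (rule sum.mono_neutral_left) auto
  also have "\<dots> = (\<Sum>k\<le>Suc n. smult (?b k * s ^ k) (?f (n + 1 - 2 * k)))
      - (\<Sum>k\<le>n. smult (?b k * s ^ Suc k) (?f (n + 1 - 2 * Suc k)))"
    by (simp add: sum_subtractf)
  also have "\<dots> = (\<Sum>k\<le>Suc n. smult (ballot n k * s ^ k) (?f (n + 1 - 2 * k)))"
    unfolding sum.atMost_Suc_shift
    by (simp add: ballot_def sum_subtractf smult_diff_left left_diff_distrib
        del: sum.atMost_Suc fibonacci_poly.simps power_Suc)
  also have "\<dots> = (\<Sum>k=0..(n + 1) div 2. smult (ballot n k * s ^ k) (?f (n + 1 - 2 * k)))"
    by (rule fibonacci_sum_extend[symmetric]) simp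
  finally show ?thesis .
qed

section \<open>Substituting the operator\<close>

lemma operator_power_eq_fibonacci_sum:
  "(x_operator (- s) q ^^ n) 1
     = (\<Sum>k=0..(n + 1) div 2. smult (ballot n k * s ^ k) (q_Fibonacci (n + 1 - 2 * k) (- s) q))"
proof -
  interpret module_hom smult smult "\<lambda>p. subst_operator p (x_operator (- s) q) 1"
    by (rule module_hom_subst_operator)
  show ?thesis
    unfolding subst_operator_monom[symmetric] monom_eq_fibonacci_sum[of n s] sum scale
      q_Fibonacci_def ..
qed

lemma operator_power_eq_lucas_sum:
  "(x_operator (- s) q ^^ n) 1
     = (\<Sum>k=0..n div 2. smult (of_nat (n choose k) * s ^ k) (q_Lucas (n - 2 * k) (- s) q))"
proof -
  interpret module_hom smult smult "\<lambda>p. subst_operator p (x_operator (- s) q) 1"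
    by (rule module_hom_subst_operator)
  show ?thesis
    unfolding subst_operator_monom[symmetric] monom_eq_fibonacci_sum[of n s]
      lucas_sum_eq_fibonacci_sum[symmetric] sum scale q_Lucas_def ..
qed

theorem theorem11:
  fixes n :: nat
  shows
    "q_Hermite n ((q_var - 1) * s_var) (q_var :: 'k::idom_divide poly poly)
       = (\<Sum>k=0..n div 2.
            smult (of_nat (n choose k) * s_var ^ k) (q_Lucas (n - 2 * k) (- s_var) q_var))
     \<and> (\<Sum>k=0..n div 2.
            smult (of_nat (n choose k) * s_var ^ k) (q_Lucas (n - 2 * k) (- s_var) q_var))
       = (\<Sum>k=0..(n + 1) div 2.
            smult ((of_nat (n choose k) - (if k = 0 then 0 else of_nat (n choose (k - 1)))) * s_var ^ k)
              (q_Fibonacci (n + 1 - 2 * k) (- s_var) (q_var :: 'k poly poly)))"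
proof -
  have "(q_var :: 'k poly poly) \<noteq> 1"
    by (simp add: q_var_def one_pCons)
  then show ?thesis
    unfolding ballot_def[symmetric] operator_power_eq_fibonacci_sum[symmetric]
      operator_power_eq_lucas_sum[symmetric]
    using q_Hermite_eq_operator_power by blast
qed

end
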